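(* Let $V$ be a nonzero finite-dimensional symplectic vector space over $\mathbf{C}$, $n\ge2$, and let $V^{n-1}:=\{(v_1,\dots,v_n)\in V^n:\sum_iv_i=0\}$ with the symplectic form restricted from $V^n$ and the permutation action of $S_n$. Then $\operatorname{HP}_0(\mathcal{O}(V^{n-1}/S_n))^*\cong\mathbf{C}$, spanned by the augmentation map $\mathcal{O}(V^{n-1})^{S_n}\to\mathbf{C}$ (evaluation at $0$). Equivalently, the Lie algebra $\mathfrak{g}$ of Hamiltonian vector fields $\xi_f$ on $V^{n-1}$ with $f\in\mathcal{O}(V^{n-1})^{S_n}$ is perfect: $\mathfrak{g}=[\mathfrak{g},\mathfrak{g}]$.
   Context: $\operatorname{HP}_0(A)=A/\{A,A\}$ for a Poisson algebra $A$; $\mathcal{O}(V^{n-1}/S_n)=\mathcal{O}(V^{n-1})^{S_n}$ with the Poisson bracket induced by the symplectic form, and $\xi_f=\{f,-\}$. *)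

theory Defs
  imports Complex_Main "HOL-Library.Poly_Mapping" "HOL-Combinatorics.Permutations"
begin

text \<open>Polynomials over C in variables indexed by pairs (i,k):
  i < n indexes the factor of V^n, k < m indexes a coordinate of V = C^m.\<close>

type_synonym cpoly = "((nat \<times> nat) \<Rightarrow>\<^sub>0 nat) \<Rightarrow>\<^sub>0 complex"

definition const_poly :: "complex \<Rightarrow> cpoly" where
  "const_poly c = Poly_Mapping.single 0 c"

definition poly_vars :: "cpoly \<Rightarrow> (nat \<times> nat) set" where
  "poly_vars p = (\<Union>mon\<in>Poly_Mapping.keys p. Poly_Mapping.keys mon)"

definition peval :: "cpoly \<Rightarrow> (nat \<times> nat \<Rightarrow> complex) \<Rightarrow> complex" where
  "peval p x = (\<Sum>mon\<in>Poly_Mapping.keys p. Poly_Mapping.lookup p mon * (\<Prod>v\<in>Poly_Mapping.keys mon. x v ^ Poly_Mapping.lookup mon v))"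

definition pderiv_var :: "nat \<times> nat \<Rightarrow> cpoly \<Rightarrow> cpoly" where
  "pderiv_var v p = (\<Sum>mon\<in>Poly_Mapping.keys p.
      Poly_Mapping.single (mon - Poly_Mapping.single v 1) (Poly_Mapping.lookup p mon * of_nat (Poly_Mapping.lookup mon v)))"

text \<open>Poisson bracket on O(V^n) for the symplectic form omega on each factor V = C^m,
  where P is the Poisson bivector (the inverse matrix of omega).\<close>
definition pbracket :: "nat \<Rightarrow> nat \<Rightarrow> (nat \<Rightarrow> nat \<Rightarrow> complex) \<Rightarrow> cpoly \<Rightarrow> cpoly \<Rightarrow> cpoly" where
  "pbracket n m P f g = (\<Sum>i<n. \<Sum>a<m. \<Sum>b<m.
      const_poly (P a b) * pderiv_var (i, a) f * pderiv_var (i, b) g)"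

text \<open>O(V^{n-1})^{S_n}, realised as the polynomials on V^n that are pulled back along the
  projection V^n = V^{n-1} (+) diag(V) -> V^{n-1} (i.e. invariant under diagonal
  translations) and invariant under the permutation action of S_n.\<close>
definition inv_alg :: "nat \<Rightarrow> nat \<Rightarrow> cpoly set" where
  "inv_alg n m = {f. poly_vars f \<subseteq> {..<n} \<times> {..<m}
      \<and> (\<forall>x w. peval f (\<lambda>(i,k). x (i,k) + w k) = peval f x)
      \<and> (\<forall>\<sigma>. \<sigma> permutes {..<n} \<longrightarrow> (\<forall>x. peval f (\<lambda>(i,k). x (\<sigma> i, k)) = peval f x))}"

definition linear_on :: "cpoly set \<Rightarrow> (cpoly \<Rightarrow> complex) \<Rightarrow> bool" where
  "linear_on A \<phi> \<longleftrightarrow> (\<forall>f\<in>A. \<forall>g\<in>A. \<phi> (f + g) = \<phi> f + \<phi> g)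
      \<and> (\<forall>c. \<forall>f\<in>A. \<phi> (const_poly c * f) = c * \<phi> f)"

definition augmentation :: "cpoly \<Rightarrow> complex" where
  "augmentation f = peval f (\<lambda>_. 0)"

end

theory Submission
  imports Defs
begin

text \<open>A trace \<open>\<phi>\<close> is pulled back to a linear functional \<open>tr\<close> on all polynomials by centring the points
  and symmetrizing. Fix the coordinate \<open>u = x\<^sub>0\<^sub>,\<^sub>0\<close> of the first point. Bracketing the power sum
  \<open>\<Sum>\<^sub>i \<langle>\<alpha>, x\<^sub>i\<rangle>\<^sup>k\<^sup>+\<^sup>1\<close> with \<open>u\<^sup>N\<^sup>+\<^sup>1 h\<close> gives, up to nonzero factors,
  \<open>u\<^sup>N (n \<langle>\<alpha>, x\<^sub>0\<rangle>\<^sup>k - \<Sum>\<^sub>i \<langle>\<alpha>, x\<^sub>i\<rangle>\<^sup>k) h\<close> plus \<open>u\<^sup>N\<^sup>+\<^sup>1 h'\<close> with \<open>deg h' = deg h + k - 1\<close>, as long as the form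
  \<open>\<alpha>\<close> pairs nontrivially with \<open>u\<close>. By induction on the degree of the cofactor of the power of \<open>u\<close> the
  last term has trace \<open>0\<close>. The case \<open>k = 1\<close> (where the sum vanishes after centring) kills every
  multiple of \<open>\<langle>\<alpha>, x\<^sub>0\<rangle>\<close>; hence \<open>u\<^sup>N h\<close> times the power sum over the remaining \<open>n - 1\<close> points has trace
  \<open>0\<close> for every \<open>k \<ge> 1\<close>. Since polarized power sums generate the \<open>S\<^sub>n\<^sub>-\<^sub>1\<close>-invariants and \<open>u\<close> is fixed
  by \<open>S\<^sub>n\<^sub>-\<^sub>1\<close>, every nonconstant monomial has trace \<open>0\<close>.\<close>

section \<open>Substitution in polynomials\<close>

definition Var :: "nat \<times> nat \<Rightarrow> cpoly" where
  "Var v = Poly_Mapping.single (Poly_Mapping.single v 1) 1"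

text \<open>The target monoid stays generic: values in \<open>cpoly\<close> serve substitution,
  complex values serve the independence of monomials.\<close>

definition mono_at :: "('a \<Rightarrow> 'b::comm_monoid_mult) \<Rightarrow> ('a \<Rightarrow>\<^sub>0 nat) \<Rightarrow> 'b" where
  "mono_at s mon = (\<Prod>v\<in>Poly_Mapping.keys mon. s v ^ Poly_Mapping.lookup mon v)"

text \<open>Evaluation, the permutation action and centring are all instances, so relations between
  them reduce to composing substitutions.\<close>

definition psubst :: "(nat \<times> nat \<Rightarrow> cpoly) \<Rightarrow> cpoly \<Rightarrow> cpoly" where
  "psubst s p = (\<Sum>mon\<in>Poly_Mapping.keys p. const_poly (Poly_Mapping.lookup p mon) * mono_at s mon)"

lemma const_poly_0 [simp]: "const_poly 0 = 0"
  and const_poly_1 [simp]: "const_poly 1 = 1"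
  and const_poly_add: "const_poly (a + b) = const_poly a + const_poly b"
  and const_poly_diff: "const_poly (a - b) = const_poly a - const_poly b"
  and const_poly_mult: "const_poly (a * b) = const_poly a * const_poly b"
  and const_poly_of_nat [simp]: "const_poly (of_nat k) = of_nat k"
  by (simp_all add: const_poly_def single_add single_diff mult_single)

lemma const_poly_sum: "const_poly (sum f A) = (\<Sum>a\<in>A. const_poly (f a))"
  by (induction A rule: infinite_finite_induct) (simp_all add: const_poly_add)

lemma const_poly_prod: "const_poly (prod f A) = (\<Prod>a\<in>A. const_poly (f a))"
  by (induction A rule: infinite_finite_induct) (simp_all add: const_poly_mult)

lemma const_poly_power: "const_poly (a ^ k) = const_poly a ^ k"
  by (induction k) (simp_all add: const_poly_mult)

lemma const_poly_inject [simp]: "const_poly a = const_poly b \<longleftrightarrow> a = b"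
  by (auto simp: const_poly_def inj_eq)

lemma sum_singles:
  fixes p :: "'a \<Rightarrow>\<^sub>0 'b::comm_monoid_add"
  shows "p = (\<Sum>k\<in>Poly_Mapping.keys p. Poly_Mapping.single k (Poly_Mapping.lookup p k))"
proof (rule poly_mapping_eqI)
  fix j
  show "Poly_Mapping.lookup p j
      = Poly_Mapping.lookup (\<Sum>k\<in>Poly_Mapping.keys p. Poly_Mapping.single k (Poly_Mapping.lookup p k)) j"
    by (simp add: lookup_sum lookup_single when_def in_keys_iff sum.delta)
qed

lemma Var_power: "Var v ^ k = Poly_Mapping.single (Poly_Mapping.single v k) 1"
  by (induction k) (simp_all add: Var_def mult_single flip: single_add)

lemma single_eq_mono: "Poly_Mapping.single mon c = const_poly c * mono_at Var mon"
proof -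
  have *: "Poly_Mapping.single (\<Sum>v\<in>S. Poly_Mapping.single v (e v)) 1 = (\<Prod>v\<in>S. Var v ^ e v)"
    if "finite S" for S and e :: "nat \<times> nat \<Rightarrow> nat"
    using that
  proof (induction S)
    case (insert v S)
    have "Var v ^ e v * (\<Prod>v\<in>S. Var v ^ e v)
        = Poly_Mapping.single (Poly_Mapping.single v (e v) + (\<Sum>v\<in>S. Poly_Mapping.single v (e v))) 1"
      unfolding insert.IH[symmetric] unfolding Var_power mult_single by simp
    with insert.hyps show ?case by simp
  qed simp
  have "Poly_Mapping.single mon 1 = mono_at Var mon"
    unfolding mono_at_def by (subst sum_singles[of mon], subst *) auto
  then show ?thesis
    by (metis add_0 const_poly_def mult.right_neutral mult_single)
qed

text \<open>With this rule, identities between algebra homomorphisms or between derivations need a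
  check only on constants and variables.\<close>

lemma cpoly_induct [case_names const Var add mult]:
  assumes "\<And>c. Q (const_poly c)" "\<And>v. Q (Var v)"
    and add: "\<And>p q. Q p \<Longrightarrow> Q q \<Longrightarrow> Q (p + q)" and mult: "\<And>p q. Q p \<Longrightarrow> Q q \<Longrightarrow> Q (p * q)"
  shows "Q (p :: cpoly)"
proof -
  have 0: "Q 0" "Q 1"
    using assms(1)[of 0] assms(1)[of 1] by simp_all
  have pow: "Q (Var v ^ k)" for v k
    by (induction k) (auto intro: 0 assms)
  have prod: "Q (\<Prod>v\<in>S. Var v ^ e v)" for S e
    by (induction S rule: infinite_finite_induct) (auto intro: 0 pow assms)
  have sum: "Q (\<Sum>k\<in>S. f k)" if "\<And>k. Q (f k)" for S and f :: "_ \<Rightarrow> cpoly"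
    using that by (induction S rule: infinite_finite_induct) (auto intro: 0 assms)
  show ?thesis
    by (subst sum_singles, rule sum) (auto simp: single_eq_mono mono_at_def intro: assms prod)
qed

lemma mono_at_0 [simp]: "mono_at s 0 = 1"
  by (simp add: mono_at_def)

lemma mono_at_superset:
  assumes "finite S" "Poly_Mapping.keys mon \<subseteq> S"
  shows "mono_at s mon = (\<Prod>v\<in>S. s v ^ Poly_Mapping.lookup mon v)"
  unfolding mono_at_def by (rule prod.mono_neutral_left) (use assms in \<open>auto simp: in_keys_iff\<close>)

lemma mono_at_add: "mono_at s (a + b) = mono_at s a * mono_at s b"
proof -
  let ?S = "Poly_Mapping.keys a \<union> Poly_Mapping.keys b"
  have "mono_at s (a + b) = (\<Prod>v\<in>?S. s v ^ Poly_Mapping.lookup (a + b) v)"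
    by (rule mono_at_superset) (auto simp: keys_add)
  also have "\<dots> = (\<Prod>v\<in>?S. s v ^ Poly_Mapping.lookup a v) * (\<Prod>v\<in>?S. s v ^ Poly_Mapping.lookup b v)"
    by (simp add: lookup_add power_add prod.distrib)
  also have "\<dots> = mono_at s a * mono_at s b"
    by (subst (1 2) mono_at_superset[of ?S]) auto
  finally show ?thesis .
qed

lemma psubst_superset:
  assumes "finite S" "Poly_Mapping.keys p \<subseteq> S"
  shows "psubst s p = (\<Sum>mon\<in>S. const_poly (Poly_Mapping.lookup p mon) * mono_at s mon)"
  unfolding psubst_def by (rule sum.mono_neutral_left) (use assms in \<open>auto simp: in_keys_iff\<close>)

lemma psubst_add: "psubst s (p + q) = psubst s p + psubst s q"
proof -
  let ?S = "Poly_Mapping.keys p \<union> Poly_Mapping.keys q"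
  have "psubst s (p + q) = (\<Sum>mon\<in>?S. const_poly (Poly_Mapping.lookup (p + q) mon) * mono_at s mon)"
    by (rule psubst_superset) (auto simp: keys_add)
  then show ?thesis
    by (subst (2 3) psubst_superset[of ?S])
      (auto simp: lookup_add const_poly_add ring_distribs sum.distrib)
qed

lemma psubst_0 [simp]: "psubst s 0 = 0"
  by (simp add: psubst_def)

lemma psubst_sum: "psubst s (sum f A) = (\<Sum>a\<in>A. psubst s (f a))"
  by (induction A rule: infinite_finite_induct) (simp_all add: psubst_add)

lemma psubst_single: "psubst s (Poly_Mapping.single mon c) = const_poly c * mono_at s mon"
  by (simp add: psubst_def)

lemma psubst_const [simp]: "psubst s (const_poly c) = const_poly c"
  by (subst const_poly_def) (simp add: psubst_single)

lemma psubst_1 [simp]: "psubst s 1 = 1"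
  using psubst_const[of s 1] by simp

lemma psubst_Var [simp]: "psubst s (Var v) = s v"
  by (simp add: Var_def psubst_single) (simp add: mono_at_def)

lemma psubst_mult: "psubst s (p * q) = psubst s p * psubst s q"
proof -
  let ?f = "\<lambda>p k. Poly_Mapping.single k (Poly_Mapping.lookup (p :: cpoly) k)"
  have "psubst s (p * q)
      = psubst s ((\<Sum>k\<in>Poly_Mapping.keys p. ?f p k) * (\<Sum>l\<in>Poly_Mapping.keys q. ?f q l))"
    using sum_singles[of p] sum_singles[of q] by simp
  also have "\<dots> = (\<Sum>k\<in>Poly_Mapping.keys p. \<Sum>l\<in>Poly_Mapping.keys q. psubst s (?f p k * ?f q l))"
    by (simp add: sum_product psubst_sum)
  also have "\<dots> = psubst s p * psubst s q"
    by (simp add: mult_single psubst_single psubst_def[of s p] psubst_def[of s q] sum_product const_poly_mult mono_at_add mult_ac)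
  finally show ?thesis .
qed

lemma psubst_diff: "psubst s (p - q) = psubst s p - psubst s q"
  by (metis add_diff_cancel diff_add_cancel psubst_add)

lemma psubst_power: "psubst s (p ^ k) = psubst s p ^ k"
  by (induction k) (simp_all add: psubst_mult)

lemma psubst_Var_id [simp]: "psubst Var p = p"
  by (induction p rule: cpoly_induct) (simp_all add: psubst_add psubst_mult)

lemma psubst_psubst: "psubst s (psubst t p) = psubst (\<lambda>v. psubst s (t v)) p"
  by (induction p rule: cpoly_induct) (simp_all add: psubst_add psubst_mult)

text \<open>Evaluation is substitution of constants. As \<open>const_poly\<close> is injective, the
  rules for \<open>peval\<close> follow from those for \<open>psubst\<close>.\<close>

lemma const_poly_peval: "const_poly (peval p x) = psubst (\<lambda>v. const_poly (x v)) p"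
  by (simp add: peval_def psubst_def const_poly_sum const_poly_mult const_poly_prod
      const_poly_power mono_at_def)

lemma peval_psubst: "peval (psubst s p) x = peval p (\<lambda>v. peval (s v) x)"
proof -
  have "const_poly (peval (psubst s p) x) = const_poly (peval p (\<lambda>v. peval (s v) x))"
    by (simp only: const_poly_peval psubst_psubst)
  then show ?thesis by simp
qed

lemma peval_const [simp]: "peval (const_poly c) x = c"
  and peval_Var [simp]: "peval (Var v) x = x v"
  and peval_0 [simp]: "peval 0 x = 0"
  and peval_1 [simp]: "peval 1 x = 1"
  and peval_add: "peval (p + q) x = peval p x + peval q x"
  and peval_diff: "peval (p - q) x = peval p x - peval q x"
  and peval_mult: "peval (p * q) x = peval p x * peval q x"
  by (simp_all add: const_poly_peval psubst_add psubst_diff psubst_mult const_poly_add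
      const_poly_diff const_poly_mult flip: const_poly_inject)

lemma peval_sum: "peval (sum f A) x = (\<Sum>a\<in>A. peval (f a) x)"
  by (induction A rule: infinite_finite_induct) (simp_all add: peval_add)

text \<open>Dedekind's argument: distinct monomials are distinct characters of the multiplicative monoid
  of points.\<close>
lemma mono_at_independent:
  fixes c :: "('a \<Rightarrow>\<^sub>0 nat) \<Rightarrow> complex"
  assumes "finite S" "\<And>x. (\<Sum>M\<in>S. c M * mono_at x M) = 0"
  shows "\<forall>M\<in>S. c M = 0"
  using assms
proof (induction S arbitrary: c)
  case (insert M0 S)
  have "c M * (mono_at y M - mono_at y M0) = 0" if "M \<in> S" for M y
  proof -
    \<comment> \<open>Take the relation at the pointwise product of \<open>x\<close> and
      \<open>y\<close> and subtract \<open>mono_at y M0\<close> times the relation at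
      \<open>x\<close>: the \<open>M0\<close> term cancels.\<close>
    have "(\<Sum>M\<in>S. (c M * (mono_at y M - mono_at y M0)) * mono_at x M) = 0" for x
    proof -
      have xy: "mono_at (\<lambda>v. x v * y v) M = mono_at x M * mono_at y M" for M
        by (simp add: mono_at_def power_mult_distrib prod.distrib)
      have "0 = (\<Sum>M\<in>insert M0 S. c M * mono_at (\<lambda>v. x v * y v) M)
          - mono_at y M0 * (\<Sum>M\<in>insert M0 S. c M * mono_at x M)"
        by (simp only: insert.prems) simp
      also have "\<dots> = (\<Sum>M\<in>insert M0 S. (c M * (mono_at y M - mono_at y M0)) * mono_at x M)"
        unfolding sum_distrib_left sum_subtractf[symmetric]
        by (rule sum.cong) (auto simp: xy algebra_simps)
      finally show ?thesis
        using insert.hyps by simp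
    qed
    from insert.IH[OF this] that show ?thesis by blast
  qed
  moreover have "\<exists>y. mono_at y M \<noteq> (mono_at y M0 :: complex)" if "M \<in> S" for M
  proof -
    have "M \<noteq> M0" using that insert.hyps by auto
    then obtain v where v: "Poly_Mapping.lookup M v \<noteq> Poly_Mapping.lookup M0 v"
      by (meson poly_mapping_eqI)
    \<comment> \<open>This point turns a monomial into 2 to the power of its exponent at
      \<open>v\<close>, which separates \<open>M\<close> from \<open>M0\<close>.\<close>
    have "mono_at (\<lambda>w. if w = v then 2 else 1) N = (2 ^ Poly_Mapping.lookup N v :: complex)" for N
      by (subst mono_at_superset[of "insert v (Poly_Mapping.keys N)"])
        (auto simp: if_distrib[of "\<lambda>x. x ^ _"] prod.delta cong: if_cong)
    moreover have "(2 ^ Poly_Mapping.lookup M v :: complex) \<noteq> 2 ^ Poly_Mapping.lookup M0 v"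
      using v by (metis of_nat_eq_iff of_nat_numeral of_nat_power one_less_numeral_iff power_inject_exp semiring_norm(76))
    ultimately show ?thesis by metis
  qed
  ultimately have S: "\<forall>M\<in>S. c M = 0"
    by fastforce
  with insert.prems[of "\<lambda>_. 1"] insert.hyps show ?case
    by (auto simp: mono_at_def)
qed simp

text \<open>\<open>inv_alg\<close> is defined through values at points, while the argument below
  uses identities of polynomials; this is the bridge.\<close>

lemma cpoly_eqI:
  assumes "\<And>x. peval p x = peval q x"
  shows "p = q"
proof -
  have "\<forall>M\<in>Poly_Mapping.keys (p - q). Poly_Mapping.lookup (p - q) M = 0"
    by (rule mono_at_independent)
      (use assms in \<open>auto simp: peval_diff[of p q, unfolded peval_def[of "p - q"]] mono_at_def\<close>)
  then show ?thesis
    by (metis eq_iff_diff_eq_0 in_keys_iff poly_mapping_eqI lookup_zero)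
qed

section \<open>Derivatives and invariants\<close>

lemma cpoly_single_induct [case_names single add]:
  assumes "\<And>mon c. Q (Poly_Mapping.single mon c)" "\<And>p q. Q p \<Longrightarrow> Q q \<Longrightarrow> Q (p + q)"
  shows "Q (p :: cpoly)"
proof -
  have "Q (\<Sum>k\<in>S. Poly_Mapping.single k (c k))" for S c
    by (induction S rule: infinite_finite_induct)
      (use assms(1)[of 0 0] in \<open>auto intro: assms\<close>)
  then show ?thesis by (subst sum_singles)
qed

lemma pderiv_var_single:
  "pderiv_var v (Poly_Mapping.single mon c)
    = Poly_Mapping.single (mon - Poly_Mapping.single v 1) (c * of_nat (Poly_Mapping.lookup mon v))"
  by (simp add: pderiv_var_def)

lemma pderiv_var_superset:
  assumes "finite S" "Poly_Mapping.keys p \<subseteq> S"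
  shows "pderiv_var v p = (\<Sum>mon\<in>S.
      Poly_Mapping.single (mon - Poly_Mapping.single v 1) (Poly_Mapping.lookup p mon * of_nat (Poly_Mapping.lookup mon v)))"
  unfolding pderiv_var_def
  by (rule sum.mono_neutral_left) (use assms in \<open>auto simp: in_keys_iff\<close>)

lemma pderiv_var_add: "pderiv_var v (p + q) = pderiv_var v p + pderiv_var v q"
  by (subst (1 2 3) pderiv_var_superset[of "Poly_Mapping.keys p \<union> Poly_Mapping.keys q"])
    (auto simp: keys_add lookup_add single_add ring_distribs sum.distrib)

lemma pderiv_var_mult:
  "pderiv_var v (p * q) = pderiv_var v p * q + p * pderiv_var v q"
proof -
  \<comment> \<open>Subtraction of exponents is truncated, so the shift needs \<open>v\<close> to
    occur in \<open>a\<close>. If it does not, the coefficient of the derivative is 0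
    anyway.\<close>
  have shift: "a - Poly_Mapping.single v 1 + b = a + b - Poly_Mapping.single v (1::nat)"
    if "Poly_Mapping.lookup a v \<noteq> 0" for a b
    by (rule poly_mapping_eqI) (use that in \<open>auto simp: lookup_add lookup_minus lookup_single when_def\<close>)
  have single: "pderiv_var v (Poly_Mapping.single a c * Poly_Mapping.single b d)
      = pderiv_var v (Poly_Mapping.single a c) * Poly_Mapping.single b d
        + Poly_Mapping.single a c * pderiv_var v (Poly_Mapping.single b d)" for a b c d
    using shift[of a b] shift[of b a]
    by (cases "Poly_Mapping.lookup a v = 0"; cases "Poly_Mapping.lookup b v = 0")
      (simp_all add: mult_single pderiv_var_single lookup_add algebra_simps flip: single_add)
  have "pderiv_var v (Poly_Mapping.single a c * q)
      = pderiv_var v (Poly_Mapping.single a c) * q + Poly_Mapping.single a c * pderiv_var v q" for a c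
    by (induction q rule: cpoly_single_induct) (simp_all add: single pderiv_var_add algebra_simps)
  then show ?thesis
    by (induction p rule: cpoly_single_induct) (simp_all add: pderiv_var_add algebra_simps)
qed

lemma pderiv_var_const [simp]: "pderiv_var v (const_poly c) = 0"
  by (simp add: const_poly_def pderiv_var_single)

lemma pderiv_var_0 [simp]: "pderiv_var v 0 = 0" and pderiv_var_1 [simp]: "pderiv_var v 1 = 0"
  using pderiv_var_const[of v 0] pderiv_var_const[of v 1] by simp_all

lemma pderiv_var_Var [simp]: "pderiv_var v (Var w) = (if v = w then 1 else 0)"
  by (auto simp: Var_def pderiv_var_single lookup_single when_def)

lemma pderiv_var_sum: "pderiv_var v (sum f A) = (\<Sum>a\<in>A. pderiv_var v (f a))"
  by (induction A rule: infinite_finite_induct) (simp_all add: pderiv_var_add)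

lemma pderiv_var_power: "pderiv_var v (p ^ Suc k) = of_nat (Suc k) * p ^ k * pderiv_var v p"
  by (induction k) (simp_all add: pderiv_var_mult algebra_simps)

lemma pderiv_var_diff: "pderiv_var v (p - q) = pderiv_var v p - pderiv_var v q"
  by (metis add_diff_cancel diff_add_cancel pderiv_var_add)

section \<open>Variables occurring in a polynomial\<close>

lemma poly_vars_const [simp]: "poly_vars (const_poly c) = {}"
  and poly_vars_Var [simp]: "poly_vars (Var v) = {v}"
  by (simp_all add: poly_vars_def const_poly_def Var_def)

lemma poly_vars_0 [simp]: "poly_vars 0 = {}"
  by (simp add: poly_vars_def)

lemma poly_vars_add: "poly_vars (p + q) \<subseteq> poly_vars p \<union> poly_vars q"
  using keys_add[of p q] by (auto simp: poly_vars_def)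

lemma poly_vars_diff: "poly_vars (p - q) \<subseteq> poly_vars p \<union> poly_vars q"
  using keys_diff[of p q] by (auto simp: poly_vars_def)

lemma poly_vars_mult: "poly_vars (p * q) \<subseteq> poly_vars p \<union> poly_vars q"
  using keys_mult[of p q] by (fastforce simp: poly_vars_def dest: subsetD[OF keys_add])

lemma poly_vars_sum: "poly_vars (sum f A) \<subseteq> (\<Union>a\<in>A. poly_vars (f a))"
  by (induction A rule: infinite_finite_induct) (use poly_vars_add in fastforce)+

lemma poly_vars_psubst: "poly_vars (psubst s p) \<subseteq> (\<Union>v. poly_vars (s v))"
proof (induction p rule: cpoly_induct)
  case (add p q)
  then show ?case using poly_vars_add[of "psubst s p" "psubst s q"] by (auto simp: psubst_add)
next
  case (mult p q)
  then show ?case using poly_vars_mult[of "psubst s p" "psubst s q"] by (auto simp: psubst_mult)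
qed auto

lemma peval_cong_vars:
  assumes "\<And>v. v \<in> poly_vars p \<Longrightarrow> x v = y v"
  shows "peval p x = peval p y"
  unfolding peval_def using assms by (intro sum.cong refl arg_cong2[of _ _ _ _ "(*)"] prod.cong)
    (auto simp: poly_vars_def intro!: arg_cong2[of _ _ _ _ "(^)"])

section \<open>Permutations, centring and the projection onto invariants\<close>

definition perm_act :: "(nat \<Rightarrow> nat) \<Rightarrow> cpoly \<Rightarrow> cpoly" where
  "perm_act \<sigma> = psubst (\<lambda>(i, k). Var (\<sigma> i, k))"

definition symmetrize :: "nat \<Rightarrow> cpoly \<Rightarrow> cpoly" where
  "symmetrize n p = (\<Sum>\<sigma> | \<sigma> permutes {..<n}. perm_act \<sigma> p)"

text \<open>Coordinates relative to the barycentre, that is, the pullback along the projection of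
  V^n onto the points of sum zero. Variables out of range go to 0, so that every polynomial lands in
  the permitted variables.\<close>

definition centred_var :: "nat \<Rightarrow> nat \<Rightarrow> nat \<times> nat \<Rightarrow> cpoly" where
  "centred_var n m = (\<lambda>(i, k). if i < n \<and> k < m
     then Var (i, k) - const_poly (1 / of_nat n) * (\<Sum>l<n. Var (l, k)) else 0)"

text \<open>For \<open>n > 0\<close> this is n! times a projection onto \<open>inv_alg n m\<close>;
  the factor is divided out only at the very end.\<close>

definition inv_proj :: "nat \<Rightarrow> nat \<Rightarrow> cpoly \<Rightarrow> cpoly" where
  "inv_proj n m p = symmetrize n (psubst (centred_var n m) p)"

lemma perm_act_const [simp]: "perm_act \<sigma> (const_poly c) = const_poly c"
  and perm_act_Var [simp]: "perm_act \<sigma> (Var (i, k)) = Var (\<sigma> i, k)"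
  and perm_act_0 [simp]: "perm_act \<sigma> 0 = 0"
  and perm_act_1 [simp]: "perm_act \<sigma> 1 = 1"
  and perm_act_add: "perm_act \<sigma> (p + q) = perm_act \<sigma> p + perm_act \<sigma> q"
  and perm_act_diff: "perm_act \<sigma> (p - q) = perm_act \<sigma> p - perm_act \<sigma> q"
  and perm_act_mult: "perm_act \<sigma> (p * q) = perm_act \<sigma> p * perm_act \<sigma> q"
  and perm_act_sum: "perm_act \<sigma> (sum f A) = (\<Sum>a\<in>A. perm_act \<sigma> (f a))"
  and perm_act_power: "perm_act \<sigma> (p ^ e) = perm_act \<sigma> p ^ e"
  by (simp_all add: perm_act_def psubst_add psubst_diff psubst_mult psubst_sum psubst_power)

lemma perm_act_perm_act: "perm_act \<sigma> (perm_act \<tau> p) = perm_act (\<sigma> \<circ> \<tau>) p"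
  by (simp add: perm_act_def psubst_psubst case_prod_unfold)

lemma pderiv_perm_act:
  assumes "inj \<sigma>"
  shows "pderiv_var (\<sigma> i, a) (perm_act \<sigma> p) = perm_act \<sigma> (pderiv_var (i, a) p)"
proof (induction p rule: cpoly_induct)
  case (Var v)
  then show ?case using assms by (cases v) (auto simp: inj_eq)
qed (simp_all add: perm_act_add perm_act_mult pderiv_var_add pderiv_var_mult)

lemma pbracket_perm_act:
  assumes "\<sigma> permutes {..<n}"
  shows "pbracket n m P (perm_act \<sigma> f) (perm_act \<sigma> g) = perm_act \<sigma> (pbracket n m P f g)"
proof -
  have inj: "inj \<sigma>" using assms by (rule permutes_inj)
  have "pbracket n m P (perm_act \<sigma> f) (perm_act \<sigma> g) = (\<Sum>i<n. \<Sum>a<m. \<Sum>b<m.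
      const_poly (P a b) * pderiv_var (\<sigma> i, a) (perm_act \<sigma> f) * pderiv_var (\<sigma> i, b) (perm_act \<sigma> g))"
    unfolding pbracket_def by (subst sum.permute[OF assms]) simp
  then show ?thesis
    by (simp add: pbracket_def pderiv_perm_act[OF inj] perm_act_sum perm_act_mult)
qed

lemma pbracket_sum_right: "pbracket n m P f (sum g A) = (\<Sum>a\<in>A. pbracket n m P f (g a))"
proof -
  have "pbracket n m P f (p + q) = pbracket n m P f p + pbracket n m P f q" for p q
    by (simp add: pbracket_def pderiv_var_add algebra_simps sum.distrib)
  moreover have "pbracket n m P f 0 = 0"
    by (simp add: pbracket_def)
  ultimately show ?thesis
    by (induction A rule: infinite_finite_induct) simp_all
qed

text \<open>Permutations preserve the bracket and fix \<open>f\<close>, so bracketing with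
  \<open>f\<close> commutes with each summand of the symmetrization.\<close>

lemma pbracket_symmetrize:
  assumes "\<And>\<sigma>. \<sigma> permutes {..<n} \<Longrightarrow> perm_act \<sigma> f = f"
  shows "pbracket n m P f (symmetrize n q) = symmetrize n (pbracket n m P f q)"
  unfolding symmetrize_def pbracket_sum_right
proof (rule sum.cong)
  fix \<sigma> assume "\<sigma> \<in> {\<sigma>. \<sigma> permutes {..<n}}"
  then show "pbracket n m P f (perm_act \<sigma> q) = perm_act \<sigma> (pbracket n m P f q)"
    using pbracket_perm_act[of \<sigma> n m P f q] assms[of \<sigma>] by simp
qed simp

lemma symmetrize_perm_act:
  assumes "\<tau> permutes {..<n}"
  shows "symmetrize n (perm_act \<tau> p) = symmetrize n p"
  unfolding symmetrize_def perm_act_perm_act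
  using sum_permutations_compose_right[OF assms, of "\<lambda>\<sigma>. perm_act \<sigma> p"] by simp

lemma perm_act_symmetrize:
  assumes "\<tau> permutes {..<n}"
  shows "perm_act \<tau> (symmetrize n p) = symmetrize n p"
  unfolding symmetrize_def perm_act_sum perm_act_perm_act
  using setum_permutations_compose_left[OF assms, of "\<lambda>\<sigma>. perm_act \<sigma> p"] by simp

lemma sum_centred_var:
  assumes "n > 0"
  shows "(\<Sum>i<n. centred_var n m (i, k)) = 0"
proof (cases "k < m")
  case True
  have "of_nat n * const_poly (1 / of_nat n) = 1"
    using assms by (simp flip: const_poly_of_nat const_poly_mult)
  then have "of_nat n * (const_poly (1 / of_nat n) * q) = q" for q
    by (metis mult.assoc mult_1)
  with True show ?thesis by (simp add: centred_var_def sum_subtractf)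
qed (simp add: centred_var_def)

lemma psubst_centred_centred:
  assumes "n > 0"
  shows "psubst (centred_var n m) (psubst (centred_var n m) p) = psubst (centred_var n m) p"
proof -
  have "psubst (centred_var n m) (centred_var n m (i, k)) = centred_var n m (i, k)" for i k
    using sum_centred_var[OF assms, of m k]
    by (subst (2) centred_var_def)
      (simp add: psubst_diff psubst_mult psubst_sum, simp add: centred_var_def)
  then have "(\<lambda>v. psubst (centred_var n m) (centred_var n m v)) = centred_var n m"
    by auto
  then show ?thesis by (simp add: psubst_psubst)
qed

lemma perm_act_psubst_centred:
  assumes "\<sigma> permutes {..<n}"
  shows "perm_act \<sigma> (psubst (centred_var n m) p) = psubst (centred_var n m) (perm_act \<sigma> p)"
proof -
  have "perm_act \<sigma> (centred_var n m (i, k)) = centred_var n m (\<sigma> i, k)" for i k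
    using sum.permute[OF assms, of "\<lambda>l. Var (l, k)", symmetric] permutes_in_image[OF assms, of i]
    by (auto simp: centred_var_def perm_act_diff perm_act_mult perm_act_sum)
  then have "(\<lambda>v. perm_act \<sigma> (centred_var n m v)) = (\<lambda>(i, k). centred_var n m (\<sigma> i, k))"
    by auto
  then show ?thesis
    by (simp add: perm_act_def psubst_psubst case_prod_unfold)
qed

text \<open>A polynomial fixed by centring depends on the centred coordinates only, and diagonal
  translations do not change these.\<close>

lemma inv_algI:
  assumes "poly_vars f \<subseteq> {..<n} \<times> {..<m}" "psubst (centred_var n m) f = f" "n > 0"
    and "\<And>\<sigma>. \<sigma> permutes {..<n} \<Longrightarrow> perm_act \<sigma> f = f"
  shows "f \<in> inv_alg n m"
proof -
  have "peval f (\<lambda>(i,k). x (i,k) + w k) = peval f x" for x :: "nat \<times> nat \<Rightarrow> complex" and w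
  proof -
    have "peval (centred_var n m v) (\<lambda>(i,k). x (i,k) + w k) = peval (centred_var n m v) x" for v
      using assms(3) by (cases v) (simp add: centred_var_def peval_diff peval_mult peval_sum sum.distrib field_simps)
    then show ?thesis
      by (metis (no_types, lifting) assms(2) peval_psubst peval_cong_vars)
  qed
  moreover have "peval f (\<lambda>(i,k). x (\<sigma> i, k)) = peval f x" if "\<sigma> permutes {..<n}" for \<sigma> x
    using arg_cong[OF assms(4)[OF that], of "\<lambda>p. peval p x"]
    by (simp add: perm_act_def peval_psubst case_prod_unfold)
  ultimately show ?thesis
    using assms(1) by (simp add: inv_alg_def)
qed

lemma inv_alg_perm_act:
  assumes "f \<in> inv_alg n m" "\<sigma> permutes {..<n}"
  shows "perm_act \<sigma> f = f"
  by (rule cpoly_eqI)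
    (use assms in \<open>simp add: perm_act_def peval_psubst case_prod_unfold inv_alg_def\<close>)

lemma inv_alg_psubst_centred:
  assumes "f \<in> inv_alg n m"
  shows "psubst (centred_var n m) f = f"
proof (rule cpoly_eqI)
  fix x :: "nat \<times> nat \<Rightarrow> complex"
  \<comment> \<open>Centring is the diagonal translation by minus the barycentre, under which
    \<open>f\<close> is invariant.\<close>
  define w where "w = (\<lambda>k. - (1 / of_nat n) * (\<Sum>l<n. x (l, k)))"
  have "peval (psubst (centred_var n m) f) x = peval f (\<lambda>(i,k). x (i,k) + w k)"
    unfolding peval_psubst
    by (rule peval_cong_vars)
      (use assms in \<open>auto simp: inv_alg_def centred_var_def w_def peval_diff peval_mult peval_sum\<close>)
  then show "peval (psubst (centred_var n m) f) x = peval f x"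
    using assms by (simp add: inv_alg_def)
qed

lemma inv_proj_in_inv_alg:
  assumes "n > 0"
  shows "inv_proj n m p \<in> inv_alg n m"
proof (rule inv_algI)
  have "poly_vars (centred_var n m v) \<subseteq> {..<n} \<times> {..<m}" for v
  proof -
    obtain i k where v: "v = (i, k)" by (cases v)
    show ?thesis
      using poly_vars_diff[of "Var (i, k)" "const_poly (1 / of_nat n) * (\<Sum>l<n. Var (l, k))"]
        poly_vars_mult[of "const_poly (1 / of_nat n)" "\<Sum>l<n. Var (l, k)"]
        poly_vars_sum[of "\<lambda>l. Var (l, k)" "{..<n}"]
      by (auto simp: v centred_var_def split: if_splits; fastforce)
  qed
  then have c: "poly_vars (psubst (centred_var n m) q) \<subseteq> {..<n} \<times> {..<m}" for q
    using poly_vars_psubst[of "centred_var n m" q] by blast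
  \<comment> \<open>Centring commutes with permutations, so it may be performed last; its range and
    idempotence then give the first two conditions.\<close>
  have eq: "inv_proj n m p = psubst (centred_var n m) (symmetrize n p)"
    by (simp add: inv_proj_def symmetrize_def perm_act_psubst_centred psubst_sum)
  show "poly_vars (inv_proj n m p) \<subseteq> {..<n} \<times> {..<m}"
    unfolding eq by (rule c)
  show "psubst (centred_var n m) (inv_proj n m p) = inv_proj n m p"
    unfolding eq by (rule psubst_centred_centred[OF assms])
qed (simp_all add: assms inv_proj_def perm_act_symmetrize)

lemma inv_proj_inv_alg:
  assumes "f \<in> inv_alg n m"
  shows "inv_proj n m f = of_nat (fact n) * f"
  using assms by (simp add: inv_proj_def inv_alg_psubst_centred symmetrize_def inv_alg_perm_act
      card_permutations)

lemma inv_proj_add: "inv_proj n m (p + q) = inv_proj n m p + inv_proj n m q"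
  and inv_proj_const_mult: "inv_proj n m (const_poly c * p) = const_poly c * inv_proj n m p"
  by (simp_all add: inv_proj_def symmetrize_def psubst_add psubst_mult perm_act_add perm_act_mult
      sum.distrib sum_distrib_left)

lemma inv_proj_perm_act:
  "\<sigma> permutes {..<n} \<Longrightarrow> inv_proj n m (perm_act \<sigma> p) = inv_proj n m p"
  by (simp add: inv_proj_def symmetrize_perm_act flip: perm_act_psubst_centred)

text \<open>Chain rule: the derivative of the centred variable of point \<open>l\<close> in the
  direction of point \<open>i\<close> is 1 - 1/n if \<open>l = i\<close> and -1/n otherwise.\<close>

lemma pderiv_psubst_centred:
  assumes "i < n" "a < m"
  shows "pderiv_var (i, a) (psubst (centred_var n m) p)
    = psubst (centred_var n m) (pderiv_var (i, a) p)
      - const_poly (1 / of_nat n) * (\<Sum>l<n. psubst (centred_var n m) (pderiv_var (l, a) p))"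
proof (induction p rule: cpoly_induct)
  case (Var v)
  obtain j b where v: "v = (j, b)" by (cases v)
  have "(\<Sum>l<n. if l = j \<and> a = b then 1 else 0 :: cpoly) = (if j < n \<and> a = b then 1 else 0)"
    by (auto simp: sum.delta)
  moreover have "(\<Sum>l<n. if i = l \<and> a = b then 1 else 0 :: cpoly) = (if a = b then 1 else 0)"
    using assms by (auto simp: sum.delta)
  ultimately show ?case
    using assms
    by (auto simp: v centred_var_def pderiv_var_diff pderiv_var_mult pderiv_var_sum
        if_distrib[of "psubst _"] cong: if_cong)
next
  case (mult p q)
  have s: "(\<Sum>l<n. psubst (centred_var n m) (pderiv_var (l, a) (p * q)))
      = (\<Sum>l<n. psubst (centred_var n m) (pderiv_var (l, a) p)) * psubst (centred_var n m) q
        + psubst (centred_var n m) p * (\<Sum>l<n. psubst (centred_var n m) (pderiv_var (l, a) q))"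
    by (simp add: pderiv_var_mult psubst_add psubst_mult sum.distrib sum_distrib_left sum_distrib_right)
  show ?case
    unfolding s unfolding psubst_mult pderiv_var_mult psubst_add mult by (simp add: algebra_simps)
next
  case (add p q)
  have s: "(\<Sum>l<n. psubst (centred_var n m) (pderiv_var (l, a) (p + q)))
      = (\<Sum>l<n. psubst (centred_var n m) (pderiv_var (l, a) p))
        + (\<Sum>l<n. psubst (centred_var n m) (pderiv_var (l, a) q))"
    by (simp add: pderiv_var_add psubst_add sum.distrib)
  show ?case
    unfolding s unfolding psubst_add pderiv_var_add add by (simp add: algebra_simps)
qed simp

text \<open>All first derivatives of \<open>f\<close> vanish at the origin: by symmetry they agree
  for all points, and by translation invariance they sum to 0 over the points.\<close>

lemma augmentation_pbracket:
  assumes "n > 0" "f \<in> inv_alg n m"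
  shows "augmentation (pbracket n m P f g) = 0"
proof -
  define c where "c i a = peval (pderiv_var (i, a) f) (\<lambda>_. 0)" for i a
  have "c i a = 0" if "i < n" "a < m" for i a
  proof -
    have "c l a = c i a" if "l < n" for l
    proof -
      define \<sigma> where "\<sigma> = transpose i l"
      have \<sigma>: "\<sigma> permutes {..<n}"
        using that \<open>i < n\<close> by (simp add: \<sigma>_def permutes_swap_id)
      have "pderiv_var (\<sigma> i, a) f = perm_act \<sigma> (pderiv_var (i, a) f)"
        using pderiv_perm_act[OF permutes_inj[OF \<sigma>], of i a f] inv_alg_perm_act[OF assms(2) \<sigma>] by simp
      then show ?thesis
        by (simp add: c_def perm_act_def peval_psubst case_prod_unfold \<sigma>_def)
    qed
    then have "(\<Sum>l<n. c l a) = of_nat n * c i a" by simp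
    moreover have "peval (psubst (centred_var n m) q) (\<lambda>_. 0) = peval q (\<lambda>_. 0)" for q
    proof -
      have "(\<lambda>v. peval (centred_var n m v) (\<lambda>_. 0)) = (\<lambda>_. 0)"
        by (auto simp: centred_var_def peval_diff peval_mult peval_sum)
      then show ?thesis by (simp add: peval_psubst)
    qed
    \<comment> \<open>The chain rule at the origin, applied to \<open>f\<close>, which centring
      fixes; it forces the sum over \<open>l\<close> to be 0.\<close>
    then have "c i a = c i a - 1 / of_nat n * (\<Sum>l<n. c l a)"
      using arg_cong[OF pderiv_psubst_centred[OF that, of f], of "\<lambda>p. peval p (\<lambda>_. 0)"]
      by (simp add: inv_alg_psubst_centred[OF assms(2)] peval_diff peval_mult peval_sum c_def)
    ultimately show ?thesis using assms(1) by simp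
  qed
  then show ?thesis
    by (simp add: augmentation_def pbracket_def peval_sum peval_mult c_def)
qed

section \<open>Hamiltonian vector fields of power sums\<close>

definition lin_form :: "nat \<Rightarrow> (nat \<Rightarrow> complex) \<Rightarrow> nat \<Rightarrow> cpoly" where
  "lin_form m \<alpha> i = (\<Sum>a<m. const_poly (\<alpha> a) * Var (i, a))"

lemma lin_form_add_scaled:
  "lin_form m (\<lambda>a. \<alpha> a + t * \<beta> a) i = lin_form m \<alpha> i + const_poly t * lin_form m \<beta> i"
  by (simp add: lin_form_def const_poly_add const_poly_mult algebra_simps sum.distrib sum_distrib_left)

lemma lin_form_basis:
  assumes "k < m"
  shows "lin_form m (\<lambda>a. if a = k then 1 else 0) i = Var (i, k)"
proof -
  have "lin_form m (\<lambda>a. if a = k then 1 else 0) i = (\<Sum>a<m. if a = k then Var (i, a) else 0)"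
    unfolding lin_form_def by (rule sum.cong) auto
  then show ?thesis using assms by simp
qed

definition power_mean :: "nat \<Rightarrow> nat \<Rightarrow> (nat \<Rightarrow> complex) \<Rightarrow> nat \<Rightarrow> cpoly" where
  "power_mean n m \<alpha> k = const_poly (1 / of_nat n) * (\<Sum>i<n. lin_form m \<alpha> i ^ k)"

text \<open>Up to the factor \<open>k + 1\<close>, the Hamiltonian vector field of the sum of the \<open>(k+1)\<close>-st powers of
  the centred linear forms, written as a derivation acting before the centring substitution.\<close>
definition power_ham ::
  "nat \<Rightarrow> nat \<Rightarrow> (nat \<Rightarrow> nat \<Rightarrow> complex) \<Rightarrow> (nat \<Rightarrow> complex) \<Rightarrow> nat \<Rightarrow> cpoly \<Rightarrow> cpoly" where
  "power_ham n m P \<alpha> k q = (\<Sum>i<n. \<Sum>a<m. \<Sum>b<m.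
     const_poly (P a b * \<alpha> a) * (lin_form m \<alpha> i ^ k - power_mean n m \<alpha> k) * pderiv_var (i, b) q)"

lemma power_ham_mult:
  "power_ham n m P \<alpha> k (p * q) = power_ham n m P \<alpha> k p * q + p * power_ham n m P \<alpha> k q"
  unfolding power_ham_def pderiv_var_mult sum_distrib_left sum_distrib_right sum.distrib[symmetric]
  by (intro sum.cong refl) (simp add: algebra_simps)

lemma power_ham_1 [simp]: "power_ham n m P \<alpha> k 1 = 0"
  by (simp add: power_ham_def)

lemma power_ham_power:
  "power_ham n m P \<alpha> k (p ^ Suc e) = of_nat (Suc e) * p ^ e * power_ham n m P \<alpha> k p"
  by (induction e) (simp_all add: power_ham_mult algebra_simps)

lemma power_ham_Var:
  assumes "j < n" "c < m"
  shows "power_ham n m P \<alpha> k (Var (j, c))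
    = const_poly (\<Sum>a<m. P a c * \<alpha> a) * (lin_form m \<alpha> j ^ k - power_mean n m \<alpha> k)"
proof -
  have "power_ham n m P \<alpha> k (Var (j, c)) = (\<Sum>i<n. \<Sum>a<m. \<Sum>b<m. if b = c then if i = j then
     const_poly (P a b * \<alpha> a) * (lin_form m \<alpha> i ^ k - power_mean n m \<alpha> k) else 0 else 0)"
    unfolding power_ham_def by (intro sum.cong refl) auto
  also have "\<dots> = (\<Sum>i<n. if i = j then \<Sum>a<m.
     const_poly (P a c * \<alpha> a) * (lin_form m \<alpha> i ^ k - power_mean n m \<alpha> k) else 0)"
    using assms by (intro sum.cong refl) auto
  finally show ?thesis
    using assms by (simp add: const_poly_sum sum_distrib_right)
qed

lemma pderiv_lin_form:
  assumes "a < m"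
  shows "pderiv_var (i, a) (lin_form m \<alpha> j) = (if i = j then const_poly (\<alpha> a) else 0)"
proof -
  have "pderiv_var (i, a) (lin_form m \<alpha> j)
      = (\<Sum>b<m. if b = a then (if i = j then const_poly (\<alpha> b) else 0) else 0)"
    unfolding lin_form_def pderiv_var_sum by (rule sum.cong) (auto simp: pderiv_var_mult)
  then show ?thesis using assms by simp
qed

text \<open>Centring adds a mean correction to both derivatives. On the side of the power sum it
  yields the subtraction of \<open>power_mean\<close>. On the side of \<open>q\<close> it is the
  term \<open>F b\<close>, independent of the point, which cancels because the coefficients
  \<open>A i\<close> sum to 0.\<close>

lemma pbracket_power_sum:
  assumes "n > 0"
  shows "pbracket n m P (psubst (centred_var n m) (\<Sum>i<n. lin_form m \<alpha> i ^ Suc k))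
      (psubst (centred_var n m) q)
    = of_nat (Suc k) * psubst (centred_var n m) (power_ham n m P \<alpha> k q)"
proof -
  let ?Y = "psubst (centred_var n m)"
  define A where "A i = ?Y (lin_form m \<alpha> i ^ k - power_mean n m \<alpha> k)" for i
  define E where "E i b = ?Y (pderiv_var (i, b) q)" for i b
  define F where "F b = const_poly (1 / of_nat n) * (\<Sum>l<n. E l b)" for b
  have dY: "pderiv_var (i, a) (?Y (\<Sum>j<n. lin_form m \<alpha> j ^ Suc k))
      = of_nat (Suc k) * const_poly (\<alpha> a) * A i" if "i < n" "a < m" for i a
  proof -
    have "pderiv_var (l, a) (\<Sum>j<n. lin_form m \<alpha> j ^ Suc k)
        = of_nat (Suc k) * const_poly (\<alpha> a) * lin_form m \<alpha> l ^ k" if "l < n" for l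
    proof -
      have "pderiv_var (l, a) (\<Sum>j<n. lin_form m \<alpha> j ^ Suc k)
          = (\<Sum>j<n. if j = l then of_nat (Suc k) * const_poly (\<alpha> a) * lin_form m \<alpha> l ^ k else 0)"
        unfolding pderiv_var_sum
        by (rule sum.cong) (auto simp: pderiv_var_power pderiv_lin_form[OF \<open>a < m\<close>] simp del: power_Suc)
      then show ?thesis using that by simp
    qed
    note this[simp]
    have "psubst (centred_var n m) (of_nat j) = of_nat j" for j
      using psubst_const[of "centred_var n m" "of_nat j"] by simp
    note this[simp]
    show ?thesis
      unfolding pderiv_psubst_centred[OF that]
      using that
      by (simp add: A_def power_mean_def psubst_mult psubst_diff psubst_sum algebra_simps
          sum_distrib_left[symmetric] del: power_Suc of_nat_Suc)
  qed
  have "of_nat n * const_poly (1 / of_nat n) = 1"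
    using assms by (simp flip: const_poly_of_nat const_poly_mult)
  then have nn: "of_nat n * (const_poly (1 / of_nat n) * q) = q" for q
    by (metis mult.assoc mult_1)
  have "(\<Sum>i<n. A i) = ?Y (\<Sum>i<n. lin_form m \<alpha> i ^ k - power_mean n m \<alpha> k)"
    by (simp add: A_def psubst_sum)
  also have "(\<Sum>i<n. lin_form m \<alpha> i ^ k - power_mean n m \<alpha> k) = 0"
    by (simp add: sum_subtractf power_mean_def nn)
  finally have A0: "(\<Sum>i<n. A i) = 0" by simp
  let ?K = "\<lambda>a b. of_nat (Suc k) * const_poly (P a b) * const_poly (\<alpha> a)"
  have dq: "pderiv_var (i, b) (?Y q) = E i b - F b" if "i < n" "b < m" for i b
    using that by (simp add: pderiv_psubst_centred E_def F_def)
  have "pbracket n m P (?Y (\<Sum>i<n. lin_form m \<alpha> i ^ Suc k)) (?Y q)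
      = (\<Sum>i<n. \<Sum>a<m. \<Sum>b<m. ?K a b * A i * (E i b - F b))"
    unfolding pbracket_def
    by (intro sum.cong refl) (simp add: dY dq mult_ac del: power_Suc of_nat_Suc)
  also have "\<dots> = (\<Sum>i<n. \<Sum>a<m. \<Sum>b<m. ?K a b * A i * E i b)
      - (\<Sum>i<n. A i * (\<Sum>a<m. \<Sum>b<m. ?K a b * F b))"
    by (simp add: right_diff_distrib sum_subtractf sum_distrib_left mult_ac del: of_nat_Suc)
  also have "(\<Sum>i<n. A i * (\<Sum>a<m. \<Sum>b<m. ?K a b * F b)) = 0"
    by (simp only: sum_distrib_right[symmetric] A0) simp
  also have "(\<Sum>i<n. \<Sum>a<m. \<Sum>b<m. ?K a b * A i * E i b)
      = of_nat (Suc k) * ?Y (power_ham n m P \<alpha> k q)"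
    by (simp add: power_ham_def psubst_sum psubst_mult A_def E_def sum_distrib_left const_poly_mult
        mult_ac del: of_nat_Suc)
  finally show ?thesis by simp
qed

section \<open>Degree\<close>

definition var_prod :: "(nat \<times> nat) list \<Rightarrow> cpoly" where
  "var_prod vs = prod_list (map Var vs)"

lemma var_prod_Nil [simp]: "var_prod [] = 1"
  and var_prod_Cons [simp]: "var_prod (v # vs) = Var v * var_prod vs"
  and var_prod_append: "var_prod (vs @ ws) = var_prod vs * var_prod ws"
  by (simp_all add: var_prod_def)

lemma var_prod_remove1: "v \<in> set vs \<Longrightarrow> var_prod vs = Var v * var_prod (remove1 v vs)"
  by (induction vs) (auto simp: mult_ac)

lemma var_prod_filter: "var_prod vs = var_prod (filter Q vs) * var_prod (filter (\<lambda>v. \<not> Q v) vs)"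
  by (induction vs) (auto simp: mult_ac)

text \<open>The bound is strict so that \<open>deg_lt 0\<close> holds for the zero polynomial alone;
  derivatives of constants then need no special case.\<close>

inductive deg_lt :: "nat \<Rightarrow> cpoly \<Rightarrow> bool" for d where
  zero: "deg_lt d 0"
| step: "length vs < d \<Longrightarrow> deg_lt d p \<Longrightarrow> deg_lt d (const_poly c * var_prod vs + p)"

lemma deg_lt_add: "deg_lt d p \<Longrightarrow> deg_lt d q \<Longrightarrow> deg_lt d (p + q)"
  by (induction rule: deg_lt.induct) (auto simp: add.assoc intro: deg_lt.intros)

lemma deg_lt_sum: "(\<And>a. a \<in> A \<Longrightarrow> deg_lt d (f a)) \<Longrightarrow> deg_lt d (sum f A)"
  by (induction A rule: infinite_finite_induct) (auto intro: deg_lt.intros deg_lt_add)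

lemma deg_lt_var_prod: "length vs < d \<Longrightarrow> deg_lt d (var_prod vs)"
  using deg_lt.step[of vs d 0 1] by (simp add: deg_lt.zero)

lemma deg_lt_const_mult: "deg_lt d p \<Longrightarrow> deg_lt d (const_poly c * p)"
proof (induction rule: deg_lt.induct)
  case (step vs p c')
  then show ?case
    using deg_lt.step[of vs d "const_poly c * p" "c * c'"]
    by (simp add: const_poly_mult algebra_simps)
qed (simp add: deg_lt.zero)

lemma deg_lt_uminus: "deg_lt d p \<Longrightarrow> deg_lt d (- p)"
  using deg_lt_const_mult[of d p "-1"] const_poly_diff[of 0 1] by simp

lemma deg_lt_diff: "deg_lt d p \<Longrightarrow> deg_lt d q \<Longrightarrow> deg_lt d (p - q)"
  using deg_lt_add[of d p "- q"] deg_lt_uminus[of d q] by simp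

text \<open>The bounds are asymmetric because two strict bounds would lose a degree; in this form no
  subtraction occurs and \<open>b = 0\<close> is covered.\<close>

lemma deg_lt_mult:
  assumes "deg_lt (Suc a) p" "deg_lt b q"
  shows "deg_lt (a + b) (p * q)"
proof -
  have *: "deg_lt (a + b) (var_prod vs * q)" if "length vs < Suc a" for vs
    using assms(2)
  proof (induction rule: deg_lt.induct)
    case (step ws q c)
    then show ?case
      using deg_lt.step[of "vs @ ws" "a + b" "var_prod vs * q" c] that
      by (simp add: var_prod_append algebra_simps)
  qed (simp add: deg_lt.zero)
  from assms(1) show ?thesis
  proof (induction rule: deg_lt.induct)
    case (step vs p c)
    then show ?case
      using deg_lt_const_mult[OF *[of vs], of c] deg_lt_add by (simp add: distrib_right mult.assoc)
  qed (simp add: deg_lt.zero)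
qed

lemma deg_lt_1: "deg_lt (Suc 0) 1"
  using deg_lt_var_prod[of "[]" "Suc 0"] by simp

lemma deg_lt_Var: "deg_lt 2 (Var v)"
  using deg_lt_var_prod[of "[v]" 2] by simp

lemma deg_lt_power:
  assumes "deg_lt 2 p"
  shows "deg_lt (Suc k) (p ^ k)"
proof (induction k)
  case (Suc k)
  show ?case
    using deg_lt_mult[of 1 p "Suc k" "p ^ k"] assms Suc by (simp add: numeral_2_eq_2)
qed (simp add: deg_lt_1)

lemma deg_lt_exists: "\<exists>d. deg_lt d p"
proof -
  have mono: "deg_lt d' p" if "deg_lt d p" "d \<le> d'" for d d' p
    using that by (induction rule: deg_lt.induct) (auto intro: deg_lt.intros)
  show ?thesis
  proof (induction p rule: cpoly_induct)
    case (const c)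
    then show ?case using deg_lt_const_mult[OF deg_lt_1, of c] by auto
  next
    case (add p q)
    then show ?case using mono deg_lt_add by (metis max.cobounded1 max.cobounded2)
  next
    case (mult p q)
    then show ?case using mono deg_lt_mult by (metis lessI less_imp_le)
  qed (use deg_lt_Var in blast)
qed

lemma deg_lt_pderiv:
  assumes "deg_lt (Suc d) p"
  shows "deg_lt d (pderiv_var v p)"
proof -
  have *: "deg_lt d (pderiv_var v (var_prod vs))" if "length vs \<le> d" for vs d
    using that
  proof (induction vs arbitrary: d)
    case (Cons w vs)
    then obtain d' where d: "d = Suc d'" by (metis Suc_le_D length_Cons Cons.prems)
    have "deg_lt d (Var w * pderiv_var v (var_prod vs))"
      using deg_lt_mult[of 1 "Var w" d' "pderiv_var v (var_prod vs)"] deg_lt_Var[of w] Cons d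
      by (simp add: numeral_2_eq_2)
    moreover have "deg_lt d (pderiv_var v (Var w) * var_prod vs)"
      using Cons.prems by (auto simp: deg_lt.zero intro: deg_lt_var_prod)
    ultimately show ?case
      by (simp add: pderiv_var_mult deg_lt_add)
  qed (simp add: deg_lt.zero)
  from assms show ?thesis
  proof (induction rule: deg_lt.induct)
    case (step vs p c)
    then show ?case
      using deg_lt_const_mult[OF *[of vs d], of c]
      by (simp add: pderiv_var_add pderiv_var_mult deg_lt_add)
  qed (simp add: deg_lt.zero)
qed

lemma deg_lt_lin_form: "deg_lt 2 (lin_form m \<alpha> i)"
  unfolding lin_form_def by (intro deg_lt_sum deg_lt_const_mult deg_lt_Var)

text \<open>Differentiation lowers the degree by one and the coefficients raise it by
  \<open>k\<close>. This bound drives the induction on the cofactor of the power of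
  \<open>U\<close>.\<close>

lemma deg_lt_power_ham:
  assumes "deg_lt (Suc d) h"
  shows "deg_lt (k + d) (power_ham n m P \<alpha> k h)"
  unfolding power_ham_def power_mean_def mult.assoc
  by (intro deg_lt_sum deg_lt_const_mult deg_lt_mult deg_lt_diff deg_lt_power deg_lt_lin_form
      deg_lt_pderiv assms)

section \<open>Poisson traces\<close>

text \<open>Nondegeneracy of the bivector enters through \<open>dual\<close>, a linear form that
  pairs to 1 with the coordinate of index 0.\<close>

locale poisson_trace =
  fixes n m :: nat and P :: "nat \<Rightarrow> nat \<Rightarrow> complex" and \<phi> :: "cpoly \<Rightarrow> complex"
    and dual :: "nat \<Rightarrow> complex"
  assumes n: "n > 0" and m: "m > 0" and linear: "linear_on (inv_alg n m) \<phi>"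
    and bracket: "\<And>f g. f \<in> inv_alg n m \<Longrightarrow> g \<in> inv_alg n m \<Longrightarrow> \<phi> (pbracket n m P f g) = 0"
    and dual: "(\<Sum>a<m. P a 0 * dual a) = 1"
begin

definition tr :: "cpoly \<Rightarrow> complex" where
  "tr p = \<phi> (inv_proj n m p)"

text \<open>The constant value of the bracket of \<open>L \<alpha> 0\<close> with \<open>U\<close>;
  forms with nonzero pairing are the generic ones below.\<close>

definition pairing :: "(nat \<Rightarrow> complex) \<Rightarrow> complex" where
  "pairing \<alpha> = (\<Sum>a<m. P a 0 * \<alpha> a)"

abbreviation "L \<equiv> lin_form m"
abbreviation "D \<equiv> power_ham n m P"
abbreviation "U \<equiv> Var (0, 0)"

lemma tr_add: "tr (p + q) = tr p + tr q"
  and tr_const_mult: "tr (const_poly c * p) = c * tr p"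
  using linear inv_proj_in_inv_alg[OF n]
  by (simp_all add: tr_def linear_on_def inv_proj_add inv_proj_const_mult)

lemma tr_0 [simp]: "tr 0 = 0"
  using tr_const_mult[of 0 0] by simp

lemma tr_diff: "tr (p - q) = tr p - tr q"
  by (metis add_diff_cancel diff_add_cancel tr_add)

lemma tr_sum: "tr (sum f A) = (\<Sum>a\<in>A. tr (f a))"
  by (induction A rule: infinite_finite_induct) (simp_all add: tr_add)

lemma tr_perm_act: "\<sigma> permutes {..<n} \<Longrightarrow> tr (perm_act \<sigma> p) = tr p"
  by (simp add: tr_def inv_proj_perm_act)

lemma tr_cong_centred:
  "psubst (centred_var n m) p = psubst (centred_var n m) q \<Longrightarrow> tr p = tr q"
  by (simp add: tr_def inv_proj_def)

text \<open>Up to the nonzero factor n! (k + 1), the projection of \<open>D \<alpha> k q\<close> is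
  the bracket of an invariant power sum with \<open>inv_proj n m q\<close>, and \<phi> kills such
  brackets.\<close>

lemma tr_power_ham: "tr (D \<alpha> k q) = 0"
proof -
  let ?Y = "psubst (centred_var n m)"
  define f where "f = ?Y (\<Sum>i<n. L \<alpha> i ^ Suc k)"
  have sym: "perm_act \<sigma> f = f" if \<sigma>: "\<sigma> permutes {..<n}" for \<sigma>
  proof -
    have "perm_act \<sigma> (\<Sum>i<n. L \<alpha> i ^ Suc k) = (\<Sum>i<n. L \<alpha> (\<sigma> i) ^ Suc k)"
      by (simp add: lin_form_def perm_act_sum perm_act_mult perm_act_power del: power_Suc)
    also have "\<dots> = (\<Sum>i<n. L \<alpha> i ^ Suc k)"
      using sum.permute[OF \<sigma>, of "\<lambda>i. L \<alpha> i ^ Suc k"] by (simp add: o_def)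
    finally show ?thesis by (simp add: f_def perm_act_psubst_centred[OF \<sigma>])
  qed
  \<comment> \<open>The multiple of \<open>f\<close> by n! is itself a value of
    \<open>inv_proj\<close>, so its membership in \<open>inv_alg n m\<close> is immediate.\<close>
  define c where "c = complex_of_nat (fact n)"
  have inv: "const_poly c * f \<in> inv_alg n m"
  proof -
    have "const_poly c = of_nat (fact n)"
      unfolding c_def by (rule const_poly_of_nat)
    then have "inv_proj n m (\<Sum>i<n. L \<alpha> i ^ Suc k) = const_poly c * f"
      by (simp add: inv_proj_def symmetrize_def sym card_permutations flip: f_def del: power_Suc)
    then show ?thesis using inv_proj_in_inv_alg[OF n] by metis
  qed
  have "pbracket n m P (const_poly c * f) (inv_proj n m q)
      = symmetrize n (pbracket n m P (const_poly c * f) (?Y q))"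
    unfolding inv_proj_def by (rule pbracket_symmetrize) (simp add: perm_act_mult sym)
  also have "pbracket n m P (const_poly c * f) (?Y q) = const_poly c * pbracket n m P f (?Y q)"
    by (simp add: pbracket_def pderiv_var_mult sum_distrib_left mult_ac)
  also have "\<dots> = const_poly (c * of_nat (Suc k)) * ?Y (D \<alpha> k q)"
    unfolding f_def pbracket_power_sum[OF n] by (simp add: const_poly_mult del: of_nat_Suc)
  also have "symmetrize n \<dots> = const_poly (c * of_nat (Suc k)) * inv_proj n m (D \<alpha> k q)"
    by (simp add: inv_proj_def symmetrize_def perm_act_mult sum_distrib_left)
  finally have "\<phi> (const_poly (c * of_nat (Suc k)) * inv_proj n m (D \<alpha> k q)) = 0"
    using bracket[OF inv inv_proj_in_inv_alg[OF n]] by metis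
  then have "c * of_nat (Suc k) * tr (D \<alpha> k q) = 0"
    using linear inv_proj_in_inv_alg[OF n, of m] unfolding linear_on_def tr_def by metis
  then show ?thesis by (simp add: c_def del: of_nat_Suc)
qed

text \<open>Leibniz on \<open>U ^ Suc N * h\<close>: the whole has trace 0, and so has the part
  where \<open>h\<close> is differentiated, hence also the part where the power of \<open>U\<close>
  is.\<close>

lemma tr_reduce:
  assumes "pairing \<alpha> \<noteq> 0" "tr (U ^ Suc N * D \<alpha> k h) = 0"
  shows "tr (U ^ N * ((L \<alpha> 0 ^ k - power_mean n m \<alpha> k) * h)) = 0"
proof -
  have "D \<alpha> k (U ^ Suc N * h)
      = const_poly (of_nat (Suc N) * pairing \<alpha>) * (U ^ N * ((L \<alpha> 0 ^ k - power_mean n m \<alpha> k) * h))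
        + U ^ Suc N * D \<alpha> k h"
    unfolding power_ham_mult power_ham_power power_ham_Var[OF n m] pairing_def const_poly_mult
      const_poly_of_nat by (simp only: mult_ac)
  then have "of_nat (Suc N) * pairing \<alpha> * tr (U ^ N * ((L \<alpha> 0 ^ k - power_mean n m \<alpha> k) * h)) = 0"
    using tr_power_ham[of \<alpha> k "U ^ Suc N * h"] assms(2) by (simp add: tr_add tr_const_mult del: of_nat_Suc power_Suc)
  then show ?thesis using assms(1) by (simp del: of_nat_Suc)
qed

text \<open>For exponent 1 the mean becomes 0 after centring, which leaves
  \<open>L \<alpha> 0\<close> alone in \<open>tr_reduce\<close>. Nongeneric forms follow by
  linearity.\<close>

lemma tr_lin_form_0:
  assumes "\<And>\<alpha>. tr (U ^ Suc N * D \<alpha> 1 h) = 0"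
  shows "tr (U ^ N * (L \<beta> 0 * h)) = 0"
proof -
  have *: "tr (U ^ N * (L \<alpha> 0 * h)) = 0" if "pairing \<alpha> \<noteq> 0" for \<alpha>
  proof -
    have "psubst (centred_var n m) (power_mean n m \<alpha> 1) = const_poly (1 / of_nat n) *
        (\<Sum>a<m. const_poly (\<alpha> a) * (\<Sum>i<n. centred_var n m (i, a)))"
      by (simp add: power_mean_def lin_form_def psubst_mult psubst_sum sum_distrib_left)
        (rule sum.swap)
    then have "psubst (centred_var n m) (power_mean n m \<alpha> 1) = 0"
      by (simp add: sum_centred_var[OF n])
    then have "tr (U ^ N * (L \<alpha> 0 * h)) = tr (U ^ N * ((L \<alpha> 0 ^ 1 - power_mean n m \<alpha> 1) * h))"
      by (intro tr_cong_centred) (simp add: psubst_mult psubst_diff)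
    then show ?thesis using tr_reduce[OF that assms] by simp
  qed
  show ?thesis
  proof (cases "pairing \<beta> = 0")
    case True
    \<comment> \<open>If \<open>pairing \<beta> = 0\<close>, then \<beta> is the difference of two
      generic forms, \<gamma> and \<open>dual\<close>, both of pairing 1.\<close>
    define \<gamma> where "\<gamma> = (\<lambda>a. dual a + 1 * \<beta> a)"
    have "pairing \<gamma> = pairing dual + pairing \<beta>"
      by (simp add: \<gamma>_def pairing_def algebra_simps sum.distrib)
    then have "pairing \<gamma> \<noteq> 0" "pairing dual \<noteq> 0"
      using True dual by (simp_all add: pairing_def)
    moreover have "L \<gamma> 0 = L dual 0 + const_poly 1 * L \<beta> 0"
      unfolding \<gamma>_def by (rule lin_form_add_scaled)
    ultimately show ?thesis
      using *[of \<gamma>] *[of dual] by (simp add: algebra_simps tr_add)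
  qed (rule *)
qed

text \<open>The mean in \<open>tr_reduce\<close> splits into the term of point 0, killed by the
  second assumption, and 1/n times the sum over the other points.\<close>

lemma tr_power_sum:
  assumes "\<And>\<alpha>. tr (U ^ Suc N * D \<alpha> k h) = 0" "\<And>\<beta>. tr (U ^ N * (L \<beta> 0 ^ k * h)) = 0"
    and "pairing \<alpha> \<noteq> 0"
  shows "tr (U ^ N * ((\<Sum>i\<in>{1..<n}. L \<alpha> i ^ k) * h)) = 0"
proof -
  have set: "{..<n} = insert 0 {1..<n}" using n by auto
  define c where "c = 1 / complex_of_nat n"
  have "U ^ N * ((L \<alpha> 0 ^ k - power_mean n m \<alpha> k) * h) = const_poly (1 - c) * (U ^ N * (L \<alpha> 0 ^ k * h))
      - const_poly c * (U ^ N * ((\<Sum>i\<in>{1..<n}. L \<alpha> i ^ k) * h))"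
    unfolding power_mean_def set by (simp add: c_def const_poly_diff algebra_simps)
  then have "0 = (1 - c) * tr (U ^ N * (L \<alpha> 0 ^ k * h)) - c * tr (U ^ N * ((\<Sum>i\<in>{1..<n}. L \<alpha> i ^ k) * h))"
    using tr_reduce[OF assms(3,1)] by (metis tr_diff tr_const_mult)
  then show ?thesis using assms(2) n by (simp add: c_def)
qed

text \<open>Polarization: the coefficient of \<open>t\<close> in the condition at \<open>\<alpha> + t\<beta>\<close> replaces one factor
  \<open>L \<alpha>\<close> by \<open>L \<beta>\<close>; the genericity assumption on \<open>\<alpha>\<close> excludes at most one value of \<open>t\<close>.\<close>
lemma tr_polarize:
  assumes "\<And>\<alpha>. pairing \<alpha> \<noteq> 0 \<Longrightarrow> tr (U ^ N * ((\<Sum>i\<in>{1..<n}. L \<alpha> i ^ k) * h)) = 0"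
    and "e + length \<beta>s = k" "pairing \<alpha> \<noteq> 0"
  shows "tr (U ^ N * ((\<Sum>i\<in>{1..<n}. L \<alpha> i ^ e * prod_list (map (\<lambda>\<beta>. L \<beta> i) \<beta>s)) * h)) = 0"
  using assms(2,3)
proof (induction \<beta>s arbitrary: e \<alpha>)
  case Nil
  then show ?case using assms(1) by simp
next
  case (Cons \<beta> \<beta>s)
  let ?R = "\<lambda>i. prod_list (map (\<lambda>\<beta>. L \<beta> i) \<beta>s)"
  \<comment> \<open>The coefficient of \<open>t ^ s\<close> in the trace at the form \<alpha> + t
    \<beta>, by the binomial theorem.\<close>
  define c where "c s = tr (const_poly (of_nat (Suc e choose s)) *
      (U ^ N * ((\<Sum>i\<in>{1..<n}. L \<beta> i ^ s * L \<alpha> i ^ (Suc e - s) * ?R i) * h)))" for s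
  have expand: "tr (U ^ N * ((\<Sum>i\<in>{1..<n}. L (\<lambda>a. \<alpha> a + t * \<beta> a) i ^ Suc e * ?R i) * h))
      = (\<Sum>s\<le>Suc e. c s * t ^ s)" for t
  proof -
    have pw: "L (\<lambda>a. \<alpha> a + t * \<beta> a) i ^ Suc e = (\<Sum>s\<le>Suc e. const_poly (t ^ s) *
        (const_poly (of_nat (Suc e choose s)) * (L \<beta> i ^ s * L \<alpha> i ^ (Suc e - s))))" for i
      unfolding lin_form_add_scaled add.commute[of "L \<alpha> i"] binomial_ring
      by (intro sum.cong refl) (simp add: power_mult_distrib const_poly_power mult_ac del: power_Suc)
    have "U ^ N * ((\<Sum>i\<in>{1..<n}. L (\<lambda>a. \<alpha> a + t * \<beta> a) i ^ Suc e * ?R i) * h)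
      = (\<Sum>i\<in>{1..<n}. \<Sum>s\<le>Suc e. const_poly (t ^ s) * (const_poly (of_nat (Suc e choose s)) *
      (U ^ N * (L \<beta> i ^ s * L \<alpha> i ^ (Suc e - s) * ?R i * h))))"
      unfolding pw sum_distrib_left sum_distrib_right by (intro sum.cong refl) (simp only: mult_ac)
    also have "\<dots> = (\<Sum>s\<le>Suc e. const_poly (t ^ s) * (const_poly (of_nat (Suc e choose s)) *
      (U ^ N * ((\<Sum>i\<in>{1..<n}. L \<beta> i ^ s * L \<alpha> i ^ (Suc e - s) * ?R i) * h))))"
      unfolding sum_distrib_left sum_distrib_right by (rule sum.swap)
    finally show ?thesis
      by (simp only: tr_sum tr_const_mult[of "t ^ _"] c_def mult.commute)
  qed
  \<comment> \<open>Outside this value of \<open>t\<close> the form \<alpha> + t \<beta> is generic.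
    If \<open>pairing \<beta> = 0\<close>, division by zero makes the removed value 0, which does no
    harm.\<close>
  have "infinite (UNIV - {- pairing \<alpha> / pairing \<beta>})"
    by (simp add: infinite_UNIV_char_0)
  moreover have "UNIV - {- pairing \<alpha> / pairing \<beta>} \<subseteq> {t. (\<Sum>s\<le>Suc e. c s * t ^ s) = 0}"
  proof
    fix t assume "t \<in> UNIV - {- pairing \<alpha> / pairing \<beta>}"
    then have "pairing \<alpha> + t * pairing \<beta> \<noteq> 0"
      using Cons.prems(2)
      by (cases "pairing \<beta> = 0") (auto simp: eq_divide_eq add_eq_0_iff2 minus_equation_iff)
    moreover have "pairing (\<lambda>a. \<alpha> a + t * \<beta> a) = pairing \<alpha> + t * pairing \<beta>"
      by (simp add: pairing_def algebra_simps sum.distrib sum_distrib_left)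
    ultimately have "(\<Sum>s\<le>Suc e. c s * t ^ s) = 0"
      using Cons.IH[of "Suc e" "\<lambda>a. \<alpha> a + t * \<beta> a"] Cons.prems(1) unfolding expand by simp
    then show "t \<in> {t. (\<Sum>s\<le>Suc e. c s * t ^ s) = 0}" by blast
  qed
  ultimately have "infinite {t. (\<Sum>s\<le>Suc e. c s * t ^ s) = 0}"
    using finite_subset by blast
  \<comment> \<open>A polynomial in \<open>t\<close> with infinitely many roots has zero
    coefficients; the one of \<open>t\<close> is e + 1 times the desired trace.\<close>
  then have "c 1 = 0"
    using polyfun_finite_roots[of c "Suc e"] by auto
  then have "of_nat (Suc e) * tr (U ^ N * ((\<Sum>i\<in>{1..<n}. L \<beta> i * L \<alpha> i ^ e * ?R i) * h)) = 0"
    unfolding c_def tr_const_mult by (simp del: of_nat_Suc)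
  then show ?case
    by (simp add: mult_ac del: of_nat_Suc)
qed

section \<open>Vanishing of the trace on nonconstant monomials\<close>

lemma tr_deg_lt:
  assumes "\<And>vs. length vs < d \<Longrightarrow> tr (q * var_prod vs) = 0" "deg_lt d p"
  shows "tr (q * p) = 0"
  using assms(2)
proof (induction rule: deg_lt.induct)
  case (step vs p c)
  have "q * (const_poly c * var_prod vs + p) = const_poly c * (q * var_prod vs) + q * p"
    by (simp add: algebra_simps)
  with step assms(1) show ?case by (simp add: tr_add tr_const_mult)
qed simp

text \<open>The outer induction is on the degree of the cofactor, for all \<open>N\<close>, since
  the reductions raise the power of \<open>U\<close>. The inner one, at fixed degree, is on the
  number of points occurring in the cofactor: in a polarized power sum times the remaining factors,
  a summand either is a permuted copy of the monomial or involves fewer points.\<close>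

lemma tr_var_prod:
  assumes "N > 0 \<or> vs \<noteq> []"
  shows "tr (U ^ N * var_prod vs) = 0"
  using assms
proof (induction "length vs" arbitrary: vs N rule: less_induct)
  case less
  note degree_IH = less.hyps
  \<comment> \<open>The extra factor \<open>U\<close> satisfies the side condition of the induction
    hypothesis even for the empty product.\<close>
  have low: "tr (U ^ Suc N * q) = 0" if "deg_lt (length vs) q" for q N
    by (rule tr_deg_lt[OF _ that], rule degree_IH) auto
  \<comment> \<open>As \<open>vs\<close> is nonempty the bound is a successor, and
    \<open>D \<alpha> 1\<close> preserves it, so \<open>low\<close> applies.\<close>
  have reduce: "tr (U ^ N * (L \<beta> 0 * q)) = 0"
    if q: "deg_lt (length vs) q" and vs: "vs \<noteq> []" for \<beta> q N
  proof (rule tr_lin_form_0, rule low)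
    obtain d where "length vs = Suc d"
      using vs by (cases vs) auto
    then show "deg_lt (length vs) (D \<alpha> 1 q)" for \<alpha>
      using deg_lt_power_ham[of d q 1 n m P \<alpha>] q by simp
  qed
  show ?case
  proof (cases "vs = []")
    case True
    then obtain M where M: "N = Suc M"
      using less.prems by (cases N) auto
    \<comment> \<open>One factor \<open>U\<close> is read as a coordinate form with cofactor 1,
      which \<open>D \<alpha> 1\<close> annihilates.\<close>
    have "tr (U ^ M * (L (\<lambda>a. if a = 0 then 1 else 0) 0 * 1)) = 0"
      by (rule tr_lin_form_0) simp
    then show ?thesis
      using True M m by (simp add: lin_form_basis mult.commute)
  next
    case nonempty: False
    have "tr (U ^ N * var_prod ws) = 0" if "length ws = length vs" for ws
      using that
    proof (induction "card (fst ` set ws)" arbitrary: ws rule: less_induct)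
      case (less ws)
      note card_IH = less.hyps and len = less.prems
      consider (outside) v where "v \<in> set ws" "v \<notin> {..<n} \<times> {..<m}"
        | (first) b where "(0, b) \<in> set ws" "b < m"
        | (rest) "\<forall>v\<in>set ws. fst v \<in> {1..<n} \<and> snd v < m"
      proof (cases "set ws \<subseteq> {..<n} \<times> {..<m} \<and> (\<forall>b<m. (0, b) \<notin> set ws)")
        case True
        have "fst v \<in> {1..<n} \<and> snd v < m" if "v \<in> set ws" for v
        proof -
          obtain i k where v: "v = (i, k)" by (cases v)
          with True that have "i < n" "k < m" by auto
          moreover have "i \<noteq> 0"
            by (rule notI) (use True that v \<open>k < m\<close> in auto)
          ultimately show ?thesis using v by simp
        qed
        with that(3) show ?thesis by blast
      qed (use that(1,2) in blast)
      then show ?case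
      proof cases
        case outside
        have "centred_var n m v = 0"
          using outside(2) by (cases v) (auto simp: centred_var_def)
        then have "tr (U ^ N * var_prod ws) = tr 0"
          by (intro tr_cong_centred) (simp add: var_prod_remove1[OF outside(1)] psubst_mult)
        then show ?thesis by simp
      next
        case first
        have "deg_lt (length vs) (var_prod (remove1 (0, b) ws))"
          by (rule deg_lt_var_prod)
            (use first len nonempty in \<open>simp add: length_remove1\<close>)
        from reduce[OF this nonempty, of N "\<lambda>a. if a = b then 1 else 0"] show ?thesis
          using first by (simp add: var_prod_remove1 lin_form_basis)
      next
        case rest
        \<comment> \<open>The monomial splits into its block at the point \<open>i0\<close>, with
          coordinates \<open>ks\<close>, and the factors \<open>us\<close> at other points;
          \<open>shift i\<close> moves the block to point \<open>i\<close>.\<close>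
        define i0 where "i0 = fst (hd ws)"
        define ks where "ks = map snd (filter (\<lambda>v. fst v = i0) ws)"
        define us where "us = filter (\<lambda>v. fst v \<noteq> i0) ws"
        define h where "h = var_prod us"
        define k where "k = length ks"
        define shift where "shift i = map (Pair i) ks @ us" for i
        have "ws \<noteq> []" using len nonempty by auto
        then have hd: "hd ws \<in> set ws" by simp
        then have i0: "i0 \<in> {1..<n}" using rest by (auto simp: i0_def)
        have ks: "k' < m" if "k' \<in> set ks" for k' using that rest by (auto simp: ks_def)
        have "hd ws \<in> set (filter (\<lambda>v. fst v = i0) ws)"
          using hd by (simp add: i0_def)
        then have "ks \<noteq> []" by (auto simp: ks_def simp del: set_filter)
        then obtain k' where k': "k = Suc k'" by (cases ks) (auto simp: k_def)
        have len': "length vs = k + length us"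
          using len sum_length_filter_compl[of "\<lambda>v. fst v = i0" ws] by (simp add: k_def ks_def us_def)
        have block: "map (Pair i0) ks = filter (\<lambda>v. fst v = i0) ws"
          unfolding ks_def map_map by (rule map_idI) auto
        have "var_prod (shift i0) = var_prod ws"
          unfolding shift_def block us_def var_prod_append by (rule var_prod_filter[symmetric])
        have fst_ws: "fst ` set ws = insert i0 (fst ` set us)" "i0 \<notin> fst ` set us"
          using hd by (auto simp: us_def i0_def)
        have "deg_lt (Suc (length us)) h"
          by (simp add: h_def deg_lt_var_prod)
        have "tr (U ^ N * ((\<Sum>i\<in>{1..<n}. L \<alpha> i ^ k) * h)) = 0" if "pairing \<alpha> \<noteq> 0" for \<alpha>
        proof (rule tr_power_sum[OF _ _ that])
          show "tr (U ^ Suc N * D \<alpha> k h) = 0" for \<alpha>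
            using deg_lt_power_ham[OF \<open>deg_lt (Suc (length us)) h\<close>, of k n m P \<alpha>]
            by (intro low) (simp add: len')
          \<comment> \<open>One factor \<open>L \<beta> 0\<close> is split off; the remaining
            cofactor has degree at most k' + \<open>length us\<close>, which is below
            \<open>length vs\<close>.\<close>
          show "tr (U ^ N * (L \<beta> 0 ^ k * h)) = 0" for \<beta>
            using reduce[OF _ nonempty, of "L \<beta> 0 ^ k' * h" N \<beta>]
              deg_lt_mult[OF deg_lt_power[OF deg_lt_lin_form] \<open>deg_lt (Suc (length us)) h\<close>, of k' m \<beta> 0]
            by (simp add: len' k' mult.assoc)
        qed
        \<comment> \<open>With \<open>e = 0\<close> all \<open>k\<close> factors are replaced by
          coordinate forms; \<open>dual\<close> serves as the generic form.\<close>
        from tr_polarize[OF this, of 0 "map (\<lambda>k a. if a = k then 1 else 0) ks" dual]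
        have "tr (U ^ N * ((\<Sum>i\<in>{1..<n}. prod_list (map (\<lambda>\<beta>. L \<beta> i)
            (map (\<lambda>k a. if a = k then 1 else 0) ks))) * h)) = 0"
          using dual by (simp add: k_def pairing_def)
        also have "(\<lambda>i. prod_list (map (\<lambda>\<beta>. L \<beta> i) (map (\<lambda>k a. if a = k then 1 else 0) ks)))
            = (\<lambda>i. var_prod (map (Pair i) ks))"
          using ks by (auto simp: var_prod_def lin_form_basis intro!: ext arg_cong[of _ _ prod_list])
        finally have sum0: "(\<Sum>i\<in>{1..<n}. tr (U ^ N * var_prod (shift i))) = 0"
          by (simp add: h_def shift_def var_prod_append sum_distrib_left sum_distrib_right tr_sum)
        \<comment> \<open>For \<open>i\<close> in \<open>A\<close> the block moves to a point not
          met by \<open>us\<close>; for the other \<open>i\<close> it merges with a point already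
          present.\<close>
        define A where "A = {i\<in>{1..<n}. i \<notin> fst ` set us}"
        have "tr (U ^ N * var_prod (shift i)) = (if i \<in> A then tr (U ^ N * var_prod ws) else 0)"
          if i: "i \<in> {1..<n}" for i
        proof (cases "i \<in> A")
          case True
          \<comment> \<open>This transposition fixes \<open>U\<close>, since both points differ from
            0, and fixes \<open>us\<close>, which meets neither of them.\<close>
          let ?\<sigma> = "transpose i0 i"
          have \<sigma>: "?\<sigma> permutes {..<n}"
            using i0 i by (simp add: permutes_swap_id)
          have act: "perm_act ?\<sigma> (var_prod us) = var_prod us"
          proof -
            have "perm_act ?\<sigma> (var_prod xs) = var_prod xs" if "set xs \<subseteq> set us" for xs
              using that
            proof (induction xs)
              case (Cons v xs)
              then have "fst v \<noteq> i0" "fst v \<noteq> i"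
                using fst_ws(2) True by (auto simp: A_def)
              with Cons show ?case by (cases v) (simp add: perm_act_mult)
            qed simp
            then show ?thesis by simp
          qed
          have "perm_act ?\<sigma> (var_prod (map (Pair i0) xs)) = var_prod (map (Pair i) xs)" for xs
            by (induction xs) (simp_all add: perm_act_mult)
          then have "perm_act ?\<sigma> (U ^ N * var_prod (shift i0)) = U ^ N * var_prod (shift i)"
            using i0 i by (simp add: shift_def var_prod_append perm_act_mult perm_act_power act)
          then show ?thesis
            using tr_perm_act[OF \<sigma>] True \<open>var_prod (shift i0) = var_prod ws\<close> by metis
        next
          case False
          then have "i \<in> fst ` set us"
            using i by (simp add: A_def)
          moreover have "fst ` set (shift i) = (\<lambda>_. i) ` set ks \<union> fst ` set us"
            by (simp add: shift_def image_Un image_image)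
          \<comment> \<open>The point \<open>i0\<close> disappears and no new point arises, so the
            inner induction hypothesis applies.\<close>
          ultimately have "fst ` set (shift i) = fst ` set us"
            by blast
          then have "card (fst ` set (shift i)) < card (fst ` set ws)"
            using fst_ws by simp
          moreover have "length (shift i) = length vs"
            by (simp add: shift_def len' k_def)
          ultimately show ?thesis using card_IH False by simp
        qed
        then have "(\<Sum>i\<in>{1..<n}. if i \<in> A then tr (U ^ N * var_prod ws) else 0) = 0"
          using sum0 by simp
        moreover have "{1..<n} \<inter> A = A" by (auto simp: A_def)
        \<comment> \<open>All surviving summands equal the wanted trace, and \<open>A\<close>
          contains \<open>i0\<close>, so their number is nonzero.\<close>
        ultimately have "of_nat (card A) * tr (U ^ N * var_prod ws) = 0"
          using sum.inter_restrict[of "{1..<n}" "\<lambda>_. tr (U ^ N * var_prod ws)" A] by simp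
        moreover have "i0 \<in> A" "finite A" using i0 fst_ws by (auto simp: A_def)
        ultimately show ?thesis by auto
      qed
    qed
    then show ?thesis by simp
  qed
qed

lemma tr_eq_augmentation: "tr p = tr 1 * augmentation p"
proof -
  obtain d where "deg_lt d p" using deg_lt_exists by blast
  then show ?thesis
  proof (induction rule: deg_lt.induct)
    case (step vs p c)
    have "tr (var_prod vs) = tr 1 * augmentation (var_prod vs)"
    proof (cases vs)
      case Nil
      then show ?thesis by (simp add: augmentation_def)
    next
      case (Cons v ws)
      then show ?thesis using tr_var_prod[of 0 vs] by (simp add: augmentation_def peval_mult)
    qed
    with step.IH show ?case
      unfolding tr_add tr_const_mult by (simp add: augmentation_def peval_add peval_mult algebra_simps)
  qed (simp add: augmentation_def)
qed

lemma trace_eq_augmentation: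
  "\<exists>c. \<forall>f\<in>inv_alg n m. \<phi> f = c * augmentation f"
proof (intro exI ballI)
  fix f assume f: "f \<in> inv_alg n m"
  have "inv_proj n m f = const_poly (of_nat (fact n)) * f"
    unfolding const_poly_of_nat using f by (rule inv_proj_inv_alg)
  then have "of_nat (fact n) * \<phi> f = tr f"
    using linear f by (simp only: linear_on_def tr_def)
  also have "\<dots> = tr 1 * augmentation f" by (rule tr_eq_augmentation)
  finally show "\<phi> f = tr 1 / of_nat (fact n) * augmentation f"
    by (simp add: field_simps)
qed

end

theorem mainTheorem12:
  fixes n m :: nat and \<omega> P :: "nat \<Rightarrow> nat \<Rightarrow> complex"
  assumes "n \<ge> 2" and "m > 0"
    and skew: "\<forall>a<m. \<forall>b<m. \<omega> a b = - \<omega> b a"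
    and inverse: "\<forall>a<m. \<forall>c<m. (\<Sum>b<m. \<omega> a b * P b c) = (if a = c then 1 else 0)"
  shows "(\<forall>f\<in>inv_alg n m. \<forall>g\<in>inv_alg n m. augmentation (pbracket n m P f g) = 0)
    \<and> (\<forall>\<phi>. linear_on (inv_alg n m) \<phi>
          \<and> (\<forall>f\<in>inv_alg n m. \<forall>g\<in>inv_alg n m. \<phi> (pbracket n m P f g) = 0)
          \<longrightarrow> (\<exists>c. \<forall>f\<in>inv_alg n m. \<phi> f = c * augmentation f))"
proof (intro conjI ballI allI impI)
  fix f g assume "f \<in> inv_alg n m"
  then show "augmentation (pbracket n m P f g) = 0"
    using \<open>n \<ge> 2\<close> by (intro augmentation_pbracket) auto
next
  fix \<phi> assume "linear_on (inv_alg n m) \<phi>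
    \<and> (\<forall>f\<in>inv_alg n m. \<forall>g\<in>inv_alg n m. \<phi> (pbracket n m P f g) = 0)"
  \<comment> \<open>The entry of index (0, 0) of the product of \<omega> and its inverse
    \<open>P\<close>: row 0 of \<omega> serves as the dual form.\<close>
  moreover have "(\<Sum>a<m. P a 0 * \<omega> 0 a) = 1"
    using inverse \<open>m > 0\<close> by (simp add: mult.commute)
  ultimately interpret poisson_trace n m P \<phi> "\<omega> 0"
    using \<open>n \<ge> 2\<close> \<open>m > 0\<close> by unfold_locales auto
  show "\<exists>c. \<forall>f\<in>inv_alg n m. \<phi> f = c * augmentation f"
    by (rule trace_eq_augmentation)
qed

end
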